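(* There exists a first-countable topological space that is selectively $3$-star-ccc but is neither weakly SSL nor selectively $2$-star-ccc.
   Context: For an open cover $\mathcal{U}$ of a space $X$ and $A\subset X$, put $\operatorname{st}^1(A,\mathcal{U})=\bigcup\{U\in\mathcal{U}:U\cap A\neq\emptyset\}$ and inductively $\operatorname{st}^{n+1}(A,\mathcal{U})=\bigcup\{U\in\mathcal{U}:U\cap \operatorname{st}^n(A,\mathcal{U})\neq\emptyset\}$. $X$ is weakly SSL (weakly strongly star-Lindelöf) if for every open cover $\mathcal{U}$ of $X$ there is a countable subset $A\subset X$ with $\overline{\operatorname{st}^1(A,\mathcal{U})}=X$. For a positive integer $k$, $X$ is selectively $k$-star-ccc if for every open cover $\mathcal{U}$ of $X$ and every sequence $(\mathcal{A}_n:n\in\omega)$ of maximal pairwise disjoint families of open subsets of $X$, there is a sequence $(A_n:n\in\omega)$ with $A_n\in\mathcal{A}_n$ for all $n$ such that $\operatorname{st}^k(\bigcup_{n\in\omega}A_n,\mathcal{U})=X$. The members of a maximal pairwise disjoint family of open sets are taken to be nonempty. *)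

theory Defs
  imports "HOL-Analysis.Analysis" "HOL-Library.Disjoint_Sets"
begin

definition open_cover :: "'a topology \<Rightarrow> 'a set set \<Rightarrow> bool" where
  "open_cover X \<U> \<longleftrightarrow> (\<forall>U\<in>\<U>. openin X U) \<and> \<Union>\<U> = topspace X"

text \<open>The iterated star of \<open>A\<close> with respect to \<open>\<U>\<close>. The value \<open>A\<close> at index \<open>0\<close> is
  a convention making the recursion uniform; only positive indices are meaningful.\<close>

primrec iterated_star :: "nat \<Rightarrow> 'a set \<Rightarrow> 'a set set \<Rightarrow> 'a set" where
  "iterated_star 0 A \<U> = A"
| "iterated_star (Suc n) A \<U> = \<Union>{U \<in> \<U>. U \<inter> iterated_star n A \<U> \<noteq> {}}"

definition weakly_SSL :: "'a topology \<Rightarrow> bool" where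
  "weakly_SSL X \<longleftrightarrow>
    (\<forall>\<U>. open_cover X \<U> \<longrightarrow>
      (\<exists>A. countable A \<and> A \<subseteq> topspace X \<and>
           X closure_of (iterated_star 1 A \<U>) = topspace X))"

definition disjoint_open_family :: "'a topology \<Rightarrow> 'a set set \<Rightarrow> bool" where
  "disjoint_open_family X \<A> \<longleftrightarrow>
    (\<forall>A\<in>\<A>. openin X A \<and> A \<noteq> {}) \<and> disjoint \<A>"

definition maximal_disjoint_open_family :: "'a topology \<Rightarrow> 'a set set \<Rightarrow> bool" where
  "maximal_disjoint_open_family X \<A> \<longleftrightarrow>
    disjoint_open_family X \<A> \<and>
    (\<forall>\<B>. disjoint_open_family X \<B> \<and> \<A> \<subseteq> \<B> \<longrightarrow> \<B> = \<A>)"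

text \<open>Intended for positive \<open>k\<close>.\<close>

definition selectively_star_ccc :: "nat \<Rightarrow> 'a topology \<Rightarrow> bool" where
  "selectively_star_ccc k X \<longleftrightarrow>
    (\<forall>\<U> (\<A> :: nat \<Rightarrow> 'a set set).
      open_cover X \<U> \<and> (\<forall>n. maximal_disjoint_open_family X (\<A> n)) \<longrightarrow>
      (\<exists>A. (\<forall>n. A n \<in> \<A> n) \<and> iterated_star k (\<Union>n. A n) \<U> = topspace X))"

end

(* In a space in which every point x has a smallest neighbourhood N x, the cover by these
   neighbourhoods refines every open cover, and first countability is trivial. Take indices
   i in [0,1) and points a_i, b_i (isolated), q_i with N q_i = {q_i, a_i, b_i}, x_i with
   N x_i = {x_i, b_i}, and hubs whose smallest neighbourhood contains every a_i. Starting from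
   the isolated point a_0, the hubs give all a_i after one star, all b_i and q_i after two and
   all x_i after three. A countable set S meets only countably many of the fibres
   {a_i, b_i, q_i, x_i}; for every other i, one star of S contains neither b_i nor x_i, so it is
   not dense, and two stars of S miss x_i. *)

theory Submission
  imports Defs
begin

text \<open>Read \<open>y \<in> N x\<close> as a relation: \<open>N x\<close> is the smallest open
  set around each \<open>x\<close> exactly when it is reflexive and transitive, the two conditions
  assumed below.\<close>

definition alexandrov_topology :: "('a \<Rightarrow> 'a set) \<Rightarrow> 'a topology" where
  "alexandrov_topology N = topology (\<lambda>U. \<forall>x\<in>U. N x \<subseteq> U)"

lemma openin_alexandrov_topology:
  "openin (alexandrov_topology N) U \<longleftrightarrow> (\<forall>x\<in>U. N x \<subseteq> U)"
proof -
  have "istopology (\<lambda>U. \<forall>x\<in>U. N x \<subseteq> U)"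
    unfolding istopology_def by blast
  then show ?thesis
    unfolding alexandrov_topology_def by simp
qed

lemma topspace_alexandrov_topology [simp]: "topspace (alexandrov_topology N) = UNIV"
  unfolding topspace_def openin_alexandrov_topology by blast

lemma first_countable_alexandrov_topology:
  assumes "\<And>x. x \<in> N x" and "\<And>x y. y \<in> N x \<Longrightarrow> N y \<subseteq> N x"
  shows "first_countable (alexandrov_topology N)"
  unfolding first_countable_def
proof
  fix x
  have "countable {N x}"
    by simp
  moreover have "openin (alexandrov_topology N) (N x)"
    using assms(2) by (auto simp: openin_alexandrov_topology)
  moreover have "\<exists>V\<in>{N x}. x \<in> V \<and> V \<subseteq> U"
    if "openin (alexandrov_topology N) U" "x \<in> U" for U
    using that assms(1) by (auto simp: openin_alexandrov_topology)
  ultimately show "\<exists>\<B>. countable \<B> \<and> (\<forall>V\<in>\<B>. openin (alexandrov_topology N) V) \<and>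
      (\<forall>U. openin (alexandrov_topology N) U \<and> x \<in> U \<longrightarrow> (\<exists>V\<in>\<B>. x \<in> V \<and> V \<subseteq> U))"
    by blast
qed

lemma open_cover_alexandrov_range:
  assumes "\<And>x. x \<in> N x" and "\<And>x y. y \<in> N x \<Longrightarrow> N y \<subseteq> N x"
  shows "open_cover (alexandrov_topology N) (range N)"
  unfolding open_cover_def
proof (intro conjI ballI)
  show "openin (alexandrov_topology N) U" if "U \<in> range N" for U
    using that assms(2) by (fastforce simp: openin_alexandrov_topology)
  show "\<Union>(range N) = topspace (alexandrov_topology N)"
    using assms(1) by auto
qed

text \<open>A member of the cover that contains \<open>y\<close> contains all of \<open>N y\<close>,
  so it meets the \<open>n\<close>-th star whenever \<open>N y\<close> does. This bounds stars from
  below for every open cover at once.\<close>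

lemma alexandrov_nbhd_subset_iterated_star:
  assumes "open_cover (alexandrov_topology N) \<U>" and "\<And>x. x \<in> N x"
    and "N y \<inter> iterated_star n A \<U> \<noteq> {}"
  shows "N y \<subseteq> iterated_star (Suc n) A \<U>"
proof -
  obtain U where U: "U \<in> \<U>" "y \<in> U"
    using assms(1) unfolding open_cover_def by fastforce
  then have "N y \<subseteq> U"
    using assms(1) unfolding open_cover_def openin_alexandrov_topology by blast
  with assms(3) U show ?thesis
    by auto
qed

text \<open>Otherwise \<open>V\<close> could be added to the family, contradicting
  maximality.\<close>

lemma maximal_disjoint_open_family_meets:
  assumes "maximal_disjoint_open_family X \<A>" and "openin X V" and "V \<noteq> {}"
  shows "\<exists>A\<in>\<A>. A \<inter> V \<noteq> {}"
proof (rule ccontr)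
  assume none: "\<not> (\<exists>A\<in>\<A>. A \<inter> V \<noteq> {})"
  then have "disjoint_open_family X (insert V \<A>)"
    using assms unfolding maximal_disjoint_open_family_def disjoint_open_family_def
    by (auto simp: disjoint_def)
  then have "insert V \<A> = \<A>"
    using assms(1) unfolding maximal_disjoint_open_family_def by blast
  with none assms(3) show False
    by blast
qed

text \<open>A member of a larger disjoint family meets the dense set \<open>M\<close> in some
  \<open>m\<close>, hence meets \<open>{m}\<close> and must equal it. Selections from such a family
  have countable union.\<close>

lemma maximal_disjoint_open_family_singletons:
  assumes "\<And>m. m \<in> M \<Longrightarrow> openin X {m}"
    and "\<And>U. openin X U \<Longrightarrow> U \<noteq> {} \<Longrightarrow> U \<inter> M \<noteq> {}"
  shows "maximal_disjoint_open_family X ((\<lambda>m. {m}) ` M)"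
  unfolding maximal_disjoint_open_family_def
proof (intro conjI allI impI)
  show "disjoint_open_family X ((\<lambda>m. {m}) ` M)"
    using assms(1) by (auto simp: disjoint_open_family_def disjoint_def)
  fix \<B>
  assume \<B>: "disjoint_open_family X \<B> \<and> (\<lambda>m. {m}) ` M \<subseteq> \<B>"
  have "B \<in> (\<lambda>m. {m}) ` M" if "B \<in> \<B>" for B
  proof -
    have "openin X B" "B \<noteq> {}"
      using \<B> that unfolding disjoint_open_family_def by auto
    then have "B \<inter> M \<noteq> {}"
      by (rule assms(2))
    then obtain m where m: "m \<in> B" "m \<in> M"
      by blast
    then have "{m} \<in> \<B>" "B \<inter> {m} \<noteq> {}"
      using \<B> by auto
    then have "B = {m}"
      using \<B> that disjointD[of \<B> B "{m}"] unfolding disjoint_open_family_def by blast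
    with m show ?thesis
      by blast
  qed
  with \<B> show "\<B> = (\<lambda>m. {m}) ` M"
    by blast
qed

text \<open>For \<open>0 \<le> i < 1\<close> the points \<open>a\<^sub>i, b\<^sub>i, q\<^sub>i, x\<^sub>i\<close> are encoded as \<open>i, i + 1, i + 2, i + 3\<close>;
  all reals outside \<open>{0..<4}\<close> are hubs.\<close>

definition hub_nbhd :: "real \<Rightarrow> real set" where
  "hub_nbhd x =
    (if 0 \<le> x \<and> x < 2 then {x}
     else if 2 \<le> x \<and> x < 3 then {x, x - 2, x - 1}
     else if 3 \<le> x \<and> x < 4 then {x, x - 2}
     else insert x {0..<1})"

abbreviation hub_space :: "real topology" where
  "hub_space \<equiv> alexandrov_topology hub_nbhd"

lemma hub_nbhd_refl: "x \<in> hub_nbhd x"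
  by (simp add: hub_nbhd_def)

lemma hub_nbhd_trans: "y \<in> hub_nbhd x \<Longrightarrow> hub_nbhd y \<subseteq> hub_nbhd x"
  by (auto simp: hub_nbhd_def split: if_splits)

lemma openin_hub_space_singleton: "0 \<le> x \<Longrightarrow> x < 2 \<Longrightarrow> openin hub_space {x}"
  by (simp add: openin_alexandrov_topology hub_nbhd_def)

lemma hub_nbhd_meets_isolated: "hub_nbhd x \<inter> {0..<2} \<noteq> {}"
proof -
  consider "0 \<le> x" "x < 2" | "2 \<le> x" "x < 4" | "x < 0 \<or> 4 \<le> x"
    by linarith
  then show ?thesis
  proof cases
    case 1
    then have "x \<in> hub_nbhd x \<inter> {0..<2}"
      by (simp add: hub_nbhd_def)
    then show ?thesis by blast
  next
    case 2
    \<comment> \<open>One witness serves both kinds of points: \<open>x - 2\<close> is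
      \<open>a_i\<close> when \<open>x = q_i\<close> and \<open>b_i\<close> when
      \<open>x = x_i\<close>.\<close>
    then have "x - 2 \<in> hub_nbhd x \<inter> {0..<2}"
      by (simp add: hub_nbhd_def)
    then show ?thesis by blast
  next
    case 3
    then have "0 \<in> hub_nbhd x \<inter> {0..<2}"
      by (auto simp: hub_nbhd_def)
    then show ?thesis by blast
  qed
qed

lemma selectively_3_star_ccc_hub_space: "selectively_star_ccc 3 hub_space"
  unfolding selectively_star_ccc_def
proof (intro allI impI)
  fix \<U> and \<A> :: "nat \<Rightarrow> real set set"
  assume asm: "open_cover hub_space \<U> \<and> (\<forall>n. maximal_disjoint_open_family hub_space (\<A> n))"
  \<comment> \<open>The point \<open>a_0 = 0\<close> is isolated, so every family has a member
    containing it.\<close>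
  have "\<exists>A\<in>\<A> n. A \<inter> {0} \<noteq> {}" for n
    using asm openin_hub_space_singleton[of 0]
    by (intro maximal_disjoint_open_family_meets) auto
  then obtain A where A: "\<And>n. A n \<in> \<A> n" "\<And>n. 0 \<in> A n"
    by (metis Int_insert_right_if0 inf_bot_right)
  let ?st = "\<lambda>k. iterated_star k (\<Union>n. A n) \<U>"
  have step: "hub_nbhd y \<subseteq> ?st (Suc n)" if "z \<in> hub_nbhd y" "z \<in> ?st n" for y z n
    using that asm
    by (intro alexandrov_nbhd_subset_iterated_star) (auto simp: hub_nbhd_refl)
  have mono: "?st n \<subseteq> ?st (Suc n)" for n
    using step hub_nbhd_refl by blast
  \<comment> \<open>Index \<open>0\<close> stands for the selected union itself, so indices below
    count the stars taken.\<close>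
  have zero: "0 \<in> ?st 0"
    using A(2) by auto
  have hubs: "x \<in> ?st (Suc 0)" if "\<not> (0 \<le> x \<and> x < 4)" for x
    using that step[of 0 x 0] zero hub_nbhd_refl[of x] by (auto simp: hub_nbhd_def simp del: iterated_star.simps)
  \<comment> \<open>Here \<open>-1\<close> is just some hub: its neighbourhood contains
    \<open>0\<close> and every \<open>a_i\<close>.\<close>
  have as: "x \<in> ?st (Suc 0)" if "0 \<le> x" "x < 1" for x
    using that step[of 0 "-1" 0] zero by (auto simp: hub_nbhd_def simp del: iterated_star.simps)
  \<comment> \<open>With \<open>x = a_i\<close>, the point \<open>x + 2\<close> is
    \<open>q_i\<close>, whose neighbourhood links \<open>a_i\<close> to \<open>b_i\<close>.\<close>
  have fibre: "hub_nbhd (x + 2) \<subseteq> ?st (Suc (Suc 0))" if "0 \<le> x" "x < 1" for x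
    using that step[of x "x + 2" "Suc 0"] as[of x] by (auto simp: hub_nbhd_def simp del: iterated_star.simps)
  have bs: "x \<in> ?st (Suc (Suc 0))" if "1 \<le> x" "x < 2" for x
    using that fibre[of "x - 1"] by (auto simp: hub_nbhd_def simp del: iterated_star.simps)
  have qs: "x \<in> ?st (Suc (Suc 0))" if "2 \<le> x" "x < 3" for x
    using that fibre[of "x - 2"] by (auto simp: hub_nbhd_def simp del: iterated_star.simps)
  have xs: "x \<in> ?st (Suc (Suc (Suc 0)))" if "3 \<le> x" "x < 4" for x
    using that step[of "x - 2" x "Suc (Suc 0)"] bs[of "x - 2"] hub_nbhd_refl[of x]
    by (auto simp: hub_nbhd_def simp del: iterated_star.simps)
  have "x \<in> ?st (Suc (Suc (Suc 0)))" for x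
  proof -
    consider "\<not> (0 \<le> x \<and> x < 4)" | "0 \<le> x" "x < 1" | "1 \<le> x" "x < 2"
      | "2 \<le> x" "x < 3" | "3 \<le> x" "x < 4"
      by linarith
    then show ?thesis
      using hubs[of x] as[of x] bs[of x] qs[of x] xs[of x]
        subsetD[OF mono[of "Suc 0"], of x] subsetD[OF mono[of "Suc (Suc 0)"], of x]
      by cases blast+
  qed
  then have "?st 3 = topspace hub_space"
    by (simp only: numeral_3_eq_3 topspace_alexandrov_topology) blast
  with A(1) show "\<exists>A. (\<forall>n. A n \<in> \<A> n) \<and> iterated_star 3 (\<Union>n. A n) \<U> = topspace hub_space"
    by blast
qed

lemma countable_star_misses_fibre:
  assumes "countable S"
  obtains i where "0 \<le> i" and "i < 1"
    and "i + 1 \<notin> iterated_star 1 S (range hub_nbhd)"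
    and "i + 3 \<notin> iterated_star 1 S (range hub_nbhd)"
proof -
  \<comment> \<open>The four shifts send a point of any fibre back to its index, so an index outside
    \<open>?T\<close> has its whole fibre outside \<open>S\<close>.\<close>
  let ?T = "S \<union> (\<lambda>s. s - 1) ` S \<union> (\<lambda>s. s - 2) ` S \<union> (\<lambda>s. s - 3) ` S"
  have "countable ?T"
    using assms by simp
  moreover have "uncountable {0..<1::real}"
    by (simp add: uncountable_half_open_interval_1)
  ultimately have "\<not> {0..<1} \<subseteq> ?T"
    by (metis countable_subset)
  then obtain i where i: "0 \<le> i" "i < 1" "i \<notin> ?T"
    unfolding subset_iff atLeastLessThan_iff by blast
  have fibre: "i \<notin> S" "i + 1 \<notin> S" "i + 2 \<notin> S" "i + 3 \<notin> S"
    using i(3) image_eqI[of i "\<lambda>s. s - 1" "i + 1" S] image_eqI[of i "\<lambda>s. s - 2" "i + 2" S]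
      image_eqI[of i "\<lambda>s. s - 3" "i + 3" S]
    by auto
  \<comment> \<open>A hub neighbourhood meets the fibre only in \<open>a_i\<close>. Thus only
    \<open>b_i\<close>, \<open>q_i\<close> and \<open>x_i\<close> can be \<open>y\<close>, and their
    neighbourhoods stay inside the fibre.\<close>
  have nbhds: "y = i + 1 \<or> y = i + 2 \<or> y = i + 3"
    if "i + 1 \<in> hub_nbhd y \<or> i + 3 \<in> hub_nbhd y" for y
    using that i(1,2) by (auto simp: hub_nbhd_def split: if_splits)
  have "hub_nbhd y \<inter> S = {}" if "y = i + 1 \<or> y = i + 2 \<or> y = i + 3" for y
    using that fibre i(1,2) by (auto simp: hub_nbhd_def add.commute split: if_splits)
  then have "i + 1 \<notin> iterated_star 1 S (range hub_nbhd)"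
    "i + 3 \<notin> iterated_star 1 S (range hub_nbhd)"
    using nbhds by auto
  with i(1,2) show thesis
    by (rule that)
qed

lemma not_weakly_SSL_hub_space: "\<not> weakly_SSL hub_space"
proof
  assume "weakly_SSL hub_space"
  then obtain S where S: "countable S"
    "hub_space closure_of (iterated_star 1 S (range hub_nbhd)) = topspace hub_space"
    unfolding weakly_SSL_def
    using open_cover_alexandrov_range[of hub_nbhd, OF hub_nbhd_refl hub_nbhd_trans] by blast
  obtain i where i: "0 \<le> i" "i < 1" "i + 1 \<notin> iterated_star 1 S (range hub_nbhd)"
    using countable_star_misses_fibre[OF S(1)] by blast
  \<comment> \<open>As \<open>b_i\<close> is isolated, missing the star puts it outside the closure
    too.\<close>
  have "openin hub_space {i + 1}"
    using i by (intro openin_hub_space_singleton) auto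
  moreover have "i + 1 \<in> hub_space closure_of (iterated_star 1 S (range hub_nbhd))"
    using S(2) by simp
  ultimately show False
    using i(3) unfolding in_closure_of by blast
qed

lemma not_selectively_2_star_ccc_hub_space: "\<not> selectively_star_ccc 2 hub_space"
proof
  assume ccc: "selectively_star_ccc 2 hub_space"
  \<comment> \<open>The constant sequence of this family forces every selection to pick one point
    per index.\<close>
  have "maximal_disjoint_open_family hub_space ((\<lambda>m. {m}) ` {0..<2})"
  proof (rule maximal_disjoint_open_family_singletons)
    show "openin hub_space {m}" if "m \<in> {0..<2}" for m
      using that by (simp add: openin_hub_space_singleton)
    show "U \<inter> {0..<2} \<noteq> {}" if "openin hub_space U" "U \<noteq> {}" for U
      using that hub_nbhd_meets_isolated unfolding openin_alexandrov_topology by blast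
  qed
  then obtain A :: "nat \<Rightarrow> real set" where A: "\<And>n. A n \<in> (\<lambda>m. {m}) ` {0..<2}"
    "iterated_star 2 (\<Union>n. A n) (range hub_nbhd) = topspace hub_space"
    using ccc open_cover_alexandrov_range[of hub_nbhd, OF hub_nbhd_refl hub_nbhd_trans]
    unfolding selectively_star_ccc_def
    by (auto dest!: spec[of _ "range hub_nbhd"] spec[of _ "\<lambda>_. (\<lambda>m. {m}) ` {0..<2}"])
  have "countable (A n)" for n
    using A(1)[of n] by auto
  then have "countable (\<Union>n. A n)"
    by simp
  then obtain i where i: "0 \<le> i" "i < 1"
    "i + 1 \<notin> iterated_star 1 (\<Union>n. A n) (range hub_nbhd)"
    "i + 3 \<notin> iterated_star 1 (\<Union>n. A n) (range hub_nbhd)"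
    by (rule countable_star_misses_fibre)
  have "i + 3 \<in> iterated_star (Suc 1) (\<Union>n. A n) (range hub_nbhd)"
    using A(2) by (simp only: Suc_1 topspace_alexandrov_topology UNIV_I)
  then obtain y where y: "i + 3 \<in> hub_nbhd y"
    "hub_nbhd y \<inter> iterated_star 1 (\<Union>n. A n) (range hub_nbhd) \<noteq> {}"
    unfolding iterated_star.simps(2)[of 1] by blast
  \<comment> \<open>No other smallest neighbourhood contains \<open>x_i\<close>, so a second star
    reaches it only if the first already meets \<open>{x_i, b_i}\<close>.\<close>
  have "y = i + 3"
    using y(1) i(1,2) by (auto simp: hub_nbhd_def split: if_splits)
  then have "hub_nbhd y = {i + 3, i + 1}"
    using i(1,2) by (auto simp: hub_nbhd_def)
  with y(2) i(3,4) show False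
    by (simp del: iterated_star.simps One_nat_def)
qed

theorem mainTheorem3:
  shows "\<exists>X :: real topology. first_countable X \<and> selectively_star_ccc 3 X \<and>
           \<not> weakly_SSL X \<and> \<not> selectively_star_ccc 2 X"
  using first_countable_alexandrov_topology[of hub_nbhd, OF hub_nbhd_refl hub_nbhd_trans]
    selectively_3_star_ccc_hub_space not_weakly_SSL_hub_space
    not_selectively_2_star_ccc_hub_space
  by blast

end
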